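(* Let $A$ be an idiom and $j\in N(A)$ a nucleus. The following statements are equivalent: (1) $j$ is spectral. (2) For all intervals $[a,b]$ of $A$ with $j\le\chi(a,b)$ we have $[a,b]\in Fll(\mathcal D_j)$.
   Context: An idiom is a complete lattice $A$ (bottom $0$, top $1$) which is modular and upper-continuous: $a\wedge\bigvee X=\bigvee\{a\wedge x\mid x\in X\}$ for all $a\in A$ and all directed $X\subseteq A$. A nucleus on $A$ is a map $j\colon A\to A$ that is monotone, satisfies $a\le j(a)$, $j(a\wedge b)=j(a)\wedge j(b)$ and $j\circ j=j$. $N(A)$ is the set of all nuclei on $A$ ordered pointwise. For $j\in N(A)$, $A_j=\{a\in A\mid j(a)=a\}$, which is itself an idiom under the induced order (bottom $j(0)$, top $1$). The nucleus $j$ is spectral if $A_j$ is a complemented lattice. For $a\le b$ the interval $[a,b]$ is $\{x\in A\mid a\le x\le b\}$. $\chi(a,b)$ denotes the nucleus on $A$ characterized by: for every $k\in N(A)$, $k\le\chi(a,b)$ if and only if $k(a)\wedge b=a$. For $j\in N(A)$, $\mathcal D_j$ is the set of intervals $[a,b]$ with $b\le j(a)$. $Fll(\mathcal D_j)$ is the set of ($j$-full) intervals $[a,b]$ such that for every $a\le x\le b$ there is $a\le y\le b$ with $x\wedge y=a$ and $[x\vee y,b]\in\mathcal D_j$. *)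

theory Defs
  imports "HOL-Algebra.Lattice"
begin

definition (in order) directed :: "'a set \<Rightarrow> bool" where
  "directed X \<longleftrightarrow> X \<noteq> {} \<and> (\<forall>x\<in>X. \<forall>y\<in>X. \<exists>z\<in>X. x \<le> z \<and> y \<le> z)"

class idiom = Complete_Lattices.complete_lattice +
  assumes modular: "(a::'a) \<le> c \<Longrightarrow> inf (sup a b) c = sup a (inf b c)"
    and upper_continuous: "directed X \<Longrightarrow> inf (a::'a) (Sup X) = Sup {inf a x |x. x \<in> X}"

definition nucleus :: "('a::idiom \<Rightarrow> 'a) \<Rightarrow> bool" where
  "nucleus j \<longleftrightarrow> mono j \<and> (\<forall>a. a \<le> j a) \<and> (\<forall>a b. j (inf a b) = inf (j a) (j b)) \<and> j \<circ> j = j"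

text \<open>The set of fixed points of \<open>j\<close> with the induced order, as an order in its own right. Joins in
  it differ from joins in the ambient idiom in general, and its bottom is \<open>j bot\<close>.\<close>

definition fixed_lattice :: "('a::idiom \<Rightarrow> 'a) \<Rightarrow> 'a gorder" where
  "fixed_lattice j = \<lparr>carrier = {a. j a = a}, eq = (=), le = (\<le>)\<rparr>"

definition complemented :: "'a gorder \<Rightarrow> bool" where
  "complemented L \<longleftrightarrow> bounded_lattice L \<and>
    (\<forall>a\<in>carrier L. \<exists>b\<in>carrier L. a \<sqinter>\<^bsub>L\<^esub> b = \<bottom>\<^bsub>L\<^esub> \<and> a \<squnion>\<^bsub>L\<^esub> b = \<top>\<^bsub>L\<^esub>)"

definition spectral :: "('a::idiom \<Rightarrow> 'a) \<Rightarrow> bool" where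
  "spectral j \<longleftrightarrow> nucleus j \<and> complemented (fixed_lattice j)"

text \<open>Meaningful for \<open>a \<le> b\<close> only; existence and uniqueness in that case are proved below.\<close>

definition chi :: "'a::idiom \<Rightarrow> 'a \<Rightarrow> 'a \<Rightarrow> 'a" where
  "chi a b = (THE c. nucleus c \<and> (\<forall>k. nucleus k \<longrightarrow> (k \<le> c \<longleftrightarrow> inf (k a) b = a)))"

text \<open>Intervals are represented as the sets \<open>{a..b}\<close> with \<open>a \<le> b\<close>; being nonempty, such a set
  determines its endpoints.\<close>

definition nuc_intervals :: "('a::idiom \<Rightarrow> 'a) \<Rightarrow> 'a set set" where
  "nuc_intervals j = {{a..b} |a b. a \<le> b \<and> b \<le> j a}"

definition Fll :: "'a::idiom set set \<Rightarrow> 'a set set" where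
  "Fll D = {{a..b} |a b. a \<le> b \<and>
     (\<forall>x\<in>{a..b}. \<exists>y\<in>{a..b}. inf x y = a \<and> {sup x y..b} \<in> D)}"

lemma chi_exists:
  fixes a b :: "'a::idiom"
  assumes "a \<le> b"
  shows "\<exists>c. nucleus c \<and> (\<forall>k. nucleus k \<longrightarrow> (k \<le> c \<longleftrightarrow> inf (k a) b = a))"
proof -
  define P where "P = {p :: 'a \<Rightarrow> 'a. mono p \<and> (\<forall>x. x \<le> p x) \<and>
    (\<forall>x y. p (inf x y) = inf (p x) (p y)) \<and> inf (p a) b = a}"
  define c where "c x = Sup ((\<lambda>p. p x) ` P)" for x
  have P_id: "id \<in> P"
    using assms by (auto simp: P_def mono_def inf_absorb1)
  have P_comp: "p \<circ> q \<in> P" if "p \<in> P" "q \<in> P" for p q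
  proof -
    have p: "mono p" "\<And>x. x \<le> p x" "\<And>x y. p (inf x y) = inf (p x) (p y)" "inf (p a) b = a"
      and q: "mono q" "\<And>x. x \<le> q x" "\<And>x y. q (inf x y) = inf (q x) (q y)" "inf (q a) b = a"
      using that by (auto simp: P_def)
    have "inf (p (q a)) b = inf (inf (p (q a)) (p b)) b"
      using p(2)[of b] by (simp add: inf.assoc inf_absorb2)
    also have "\<dots> = inf (p (inf (q a) b)) b" by (simp add: p(3))
    also have "\<dots> = a" by (simp add: q(4) p(4))
    finally have "inf (p (q a)) b = a" .
    moreover have "x \<le> p (q x)" for x using p(2) q(2) order_trans by blast
    moreover have "mono (p \<circ> q)" using p(1) q(1) by (simp add: monotone_on_o mono_def)
    ultimately show ?thesis by (simp add: P_def p(3) q(3))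
  qed
  have dom: "\<exists>r\<in>P. (\<forall>x. p x \<le> r x) \<and> (\<forall>x. q x \<le> r x)" if "p \<in> P" "q \<in> P" for p q
  proof (intro bexI conjI allI)
    show "p x \<le> (p \<circ> q) x" for x using that by (auto simp: P_def mono_def)
    show "q x \<le> (p \<circ> q) x" for x using that by (auto simp: P_def)
  qed (rule P_comp[OF that])
  have c_upper: "p x \<le> c x" if "p \<in> P" for p x
    unfolding c_def using that by (blast intro: Sup_upper)
  have dist: "inf y (c x) = Sup ((\<lambda>p. inf y (p x)) ` P)" for x y
  proof -
    have "directed ((\<lambda>p. p x) ` P)"
      unfolding directed_def ball_simps bex_simps image_is_empty using P_id dom by blast
    then have "inf y (Sup ((\<lambda>p. p x) ` P)) = Sup {inf y z |z. z \<in> (\<lambda>p. p x) ` P}"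
      by (rule upper_continuous)
    also have "{inf y z |z. z \<in> (\<lambda>p. p x) ` P} = (\<lambda>p. inf y (p x)) ` P" by auto
    finally show ?thesis by (simp add: c_def)
  qed
  have c_mono: "mono c"
  proof (rule monoI)
    fix x y :: 'a assume "x \<le> y"
    then have "p x \<le> c y" if "p \<in> P" for p
      using c_upper[OF that, of y] that by (auto simp: P_def mono_def intro: order_trans)
    then show "c x \<le> c y" unfolding c_def[of x] by (blast intro: Sup_least)
  qed
  have c_infl: "x \<le> c x" for x using c_upper[OF P_id] by simp
  have c_inf: "c (inf x y) = inf (c x) (c y)" for x y
  proof (rule antisym)
    show "c (inf x y) \<le> inf (c x) (c y)" using c_mono by (auto simp: mono_def)
    have "inf (p x) (q y) \<le> c (inf x y)" if "p \<in> P" "q \<in> P" for p q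
    proof -
      obtain r where r: "r \<in> P" "\<And>x. p x \<le> r x" "\<And>x. q x \<le> r x"
        using dom[OF \<open>p \<in> P\<close> \<open>q \<in> P\<close>] by blast
      then have "inf (p x) (q y) \<le> inf (r x) (r y)" by (blast intro: inf_mono)
      also have "\<dots> = r (inf x y)" using r(1) by (simp add: P_def)
      also have "\<dots> \<le> c (inf x y)" by (rule c_upper[OF r(1)])
      finally show ?thesis .
    qed
    then have "inf (p x) (c y) \<le> c (inf x y)" if "p \<in> P" for p
      unfolding dist using that by (blast intro: Sup_least)
    then have "inf (c y) (c x) \<le> c (inf x y)"
      unfolding dist[of "c y" x] by (auto intro!: Sup_least simp: inf.commute)
    then show "inf (c x) (c y) \<le> c (inf x y)" by (simp add: inf.commute)
  qed
  have c_ab: "inf (c a) b = a"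
  proof -
    have "inf b (c a) = Sup ((\<lambda>p. a) ` P)"
      unfolding dist by (rule arg_cong[where f = Sup], rule image_cong)
        (auto simp: P_def inf.commute)
    then show ?thesis using P_id by (auto simp: inf.commute image_constant_conv)
  qed
  have c_P: "c \<in> P" using c_mono c_infl c_inf c_ab by (simp add: P_def)
  have "c (c x) = c x" for x
    using c_upper[OF P_comp[OF c_P c_P], of x] c_infl[of "c x"] by (simp add: antisym)
  then have nuc: "nucleus c"
    using c_mono c_infl c_inf by (auto simp: nucleus_def)
  moreover have "k \<le> c \<longleftrightarrow> inf (k a) b = a" if k: "nucleus k" for k
  proof
    assume "k \<le> c"
    then have "inf (k a) b \<le> inf (c a) b" by (intro inf_mono) (auto simp: le_fun_def)
    moreover have "a \<le> k a" using k by (simp add: nucleus_def)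
    ultimately show "inf (k a) b = a" using c_ab assms by (simp add: antisym)
  next
    assume "inf (k a) b = a"
    then have "k \<in> P" using k by (simp add: P_def nucleus_def)
    then show "k \<le> c" using c_upper by (simp add: le_fun_def)
  qed
  ultimately show ?thesis by blast
qed

lemma
  fixes a b :: "'a::idiom"
  assumes "a \<le> b"
  shows nucleus_chi: "nucleus (chi a b)"
    and le_chi_iff: "nucleus k \<Longrightarrow> k \<le> chi a b \<longleftrightarrow> inf (k a) b = a"
proof -
  have "\<exists>!c. nucleus c \<and> (\<forall>k. nucleus k \<longrightarrow> (k \<le> c \<longleftrightarrow> inf (k a) b = a))"
    using chi_exists[OF assms] by (rule ex_ex1I) (meson antisym order_refl)
  from theI'[OF this] show "nucleus (chi a b)"
    and "nucleus k \<Longrightarrow> k \<le> chi a b \<longleftrightarrow> inf (k a) b = a"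
    by (simp_all add: chi_def)
qed

end

theory Submission
  imports Defs
begin

text \<open>
  The fixed points of a nucleus \<open>j\<close> form a bounded lattice with meet \<open>inf\<close>, join
  \<open>j (sup a c)\<close>, least element \<open>j bot\<close> and greatest element \<open>top\<close>, so spectrality says that each fixed point \<open>x\<close>
  has some \<open>y\<close> with \<open>inf x y = j bot\<close> and \<open>j (sup x y) = top\<close> (lemma \<open>spectral_iff\<close>). On the
  other side, \<open>j \<le> chi a b\<close> means \<open>inf (j a) b = a\<close>, and \<open>j\<close>-fullness of \<open>[a, b]\<close> says that
  each \<open>x\<close> in it has a relative complement up to \<open>j\<close>. The theorem is therefore a version, up
  to \<open>j\<close>, of the fact that a bounded modular lattice is complemented iff all its intervals are.

  If fullness holds, the single interval \<open>[j bot, top]\<close> suffices: a relative complement up to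
  \<open>j\<close> of a fixed point becomes a complement in the fixed lattice after applying \<open>j\<close>.

  Conversely, let \<open>inf (j a) b = a\<close> and \<open>a \<le> x \<le> b\<close>, and let \<open>c\<close> be a complement of \<open>j x\<close>
  among the fixed points. The modular law turns \<open>c\<close> into a relative complement of \<open>x\<close>: first
  push \<open>c\<close> up to \<open>z = j (sup a c)\<close>, then cut it down to \<open>y = inf z b\<close>. Modularity at
  \<open>a \<le> j x\<close> gives \<open>inf (j x) z = j a\<close>, so \<open>inf x y\<close> lies below \<open>inf (j a) b = a\<close>; modularity
  at \<open>x \<le> b\<close> gives \<open>sup x y = inf (sup x z) b\<close>, and \<open>j\<close> sends \<open>sup x z\<close> to \<open>top\<close>, so
  \<open>b \<le> j (sup x y)\<close>.
\<close>

context
  fixes j :: "'a::idiom \<Rightarrow> 'a"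
  assumes nuc: "nucleus j"
begin

lemma nucleus_mono: "x \<le> y \<Longrightarrow> j x \<le> j y"
  using nuc by (auto simp: nucleus_def mono_def)

lemma nucleus_le: "x \<le> j x"
  using nuc by (simp add: nucleus_def)

lemma nucleus_inf: "j (inf x y) = inf (j x) (j y)"
  using nuc by (simp add: nucleus_def)

lemma nucleus_idem [simp]: "j (j x) = j x"
  using nuc by (metis nucleus_def comp_apply)

lemma nucleus_top: "j Orderings.top = Orderings.top"
  by (rule top_le) (rule nucleus_le)

lemma nucleus_bot_le_fixed: "j x = x \<Longrightarrow> j bot \<le> x"
  using nucleus_mono[OF bot_least, of x] by simp

text \<open>An upper bound of \<open>x\<close> fixed by \<open>j\<close> is also one of \<open>j x\<close>, so closing an argument under
  \<open>j\<close> first does not change the closed join. This moves joins between the idiom and its fixed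
  points.\<close>

lemma nucleus_sup_absorb: "j (sup (j x) y) = j (sup x y)"
proof (rule antisym)
  have "sup (j x) y \<le> j (sup x y)"
    using nucleus_mono[of x "sup x y"] nucleus_le[of "sup x y"] by simp
  then show "j (sup (j x) y) \<le> j (sup x y)"
    using nucleus_mono[of "sup (j x) y" "j (sup x y)"] by simp
  show "j (sup x y) \<le> j (sup (j x) y)"
    by (rule nucleus_mono) (rule sup_mono[OF nucleus_le order_refl])
qed

lemma fixed_lattice_least_Upper:
  assumes "j a = a" "j c = c"
  shows "least (fixed_lattice j) (j (sup a c)) (Upper (fixed_lattice j) {a, c})"
proof -
  have "j (sup a c) \<le> u" if "j u = u" "a \<le> u" "c \<le> u" for u
    using nucleus_mono[of "sup a c" u] that by simp
  moreover have "a \<le> j (sup a c)" "c \<le> j (sup a c)"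
    using nucleus_le[of "sup a c"] by simp_all
  ultimately show ?thesis
    using assms by (auto simp: least_def Upper_def fixed_lattice_def)
qed

lemma fixed_lattice_greatest_Lower:
  assumes "j a = a" "j c = c"
  shows "greatest (fixed_lattice j) (inf a c) (Lower (fixed_lattice j) {a, c})"
  using assms by (auto simp: greatest_def Lower_def fixed_lattice_def nucleus_inf)

lemma bounded_lattice_fixed_lattice: "bounded_lattice (fixed_lattice j)"
proof -
  interpret partial_order "fixed_lattice j"
    by unfold_locales (auto simp: fixed_lattice_def)
  show ?thesis
  proof unfold_locales
    fix x y assume "x \<in> carrier (fixed_lattice j)" "y \<in> carrier (fixed_lattice j)"
    then have "j x = x" "j y = y" by (simp_all add: fixed_lattice_def)
    then show "\<exists>s. least (fixed_lattice j) s (Upper (fixed_lattice j) {x, y})"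
      and "\<exists>s. greatest (fixed_lattice j) s (Lower (fixed_lattice j) {x, y})"
      using fixed_lattice_least_Upper fixed_lattice_greatest_Lower by blast+
  next
    have "least (fixed_lattice j) (j bot) (carrier (fixed_lattice j))"
      by (simp add: least_def fixed_lattice_def nucleus_bot_le_fixed)
    then show "\<exists>x. least (fixed_lattice j) x (carrier (fixed_lattice j))" ..
    have "greatest (fixed_lattice j) Orderings.top (carrier (fixed_lattice j))"
      by (simp add: greatest_def fixed_lattice_def nucleus_top)
    then show "\<exists>x. greatest (fixed_lattice j) x (carrier (fixed_lattice j))" ..
  qed
qed

lemma fixed_lattice_simps:
  shows fixed_lattice_bottom: "\<bottom>\<^bsub>fixed_lattice j\<^esub> = j bot"
    and fixed_lattice_top: "\<top>\<^bsub>fixed_lattice j\<^esub> = Orderings.top"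
    and fixed_lattice_meet: "\<lbrakk>j a = a; j c = c\<rbrakk> \<Longrightarrow> a \<sqinter>\<^bsub>fixed_lattice j\<^esub> c = inf a c"
    and fixed_lattice_join: "\<lbrakk>j a = a; j c = c\<rbrakk> \<Longrightarrow> a \<squnion>\<^bsub>fixed_lattice j\<^esub> c = j (sup a c)"
proof -
  interpret bounded_lattice "fixed_lattice j" by (rule bounded_lattice_fixed_lattice)
  show "\<bottom>\<^bsub>fixed_lattice j\<^esub> = j bot"
    by (intro bottom_eq[symmetric]) (simp_all add: fixed_lattice_def nucleus_bot_le_fixed)
  show "\<top>\<^bsub>fixed_lattice j\<^esub> = Orderings.top"
    by (intro top_eq[symmetric]) (simp_all add: fixed_lattice_def nucleus_top)
  assume fixed: "j a = a" "j c = c"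
  then have carrier: "a \<in> carrier (fixed_lattice j)" "c \<in> carrier (fixed_lattice j)"
    by (simp_all add: fixed_lattice_def)
  show "a \<sqinter>\<^bsub>fixed_lattice j\<^esub> c = inf a c"
    by (rule greatest_unique[OF inf_of_two_greatest[OF carrier, folded meet_def]
          fixed_lattice_greatest_Lower[OF fixed]])
  show "a \<squnion>\<^bsub>fixed_lattice j\<^esub> c = j (sup a c)"
    by (rule least_unique[OF sup_of_two_least[OF carrier, folded join_def]
          fixed_lattice_least_Upper[OF fixed]])
qed

lemma spectral_iff:
  "spectral j \<longleftrightarrow>
    (\<forall>x. j x = x \<longrightarrow> (\<exists>y. j y = y \<and> inf x y = j bot \<and> j (sup x y) = Orderings.top))"
proof -
  have carrier: "carrier (fixed_lattice j) = {a. j a = a}"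
    by (simp add: fixed_lattice_def)
  show ?thesis
    unfolding spectral_def complemented_def carrier
    using nuc bounded_lattice_fixed_lattice by (auto simp: fixed_lattice_simps)
qed

end

text \<open>An interval determines its endpoints, so the endpoints bound in the definitions of
  \<open>nuc_intervals\<close> and \<open>Fll\<close> can be read off.\<close>

lemma atLeastAtMost_mem_nuc_intervals_iff:
  assumes "a \<le> b"
  shows "{a..b} \<in> nuc_intervals j \<longleftrightarrow> b \<le> j a"
  using assms by (auto simp: nuc_intervals_def)

lemma atLeastAtMost_mem_Fll_nuc_intervals_iff:
  fixes a b :: "'a::idiom"
  assumes "a \<le> b"
  shows "{a..b} \<in> Fll (nuc_intervals j) \<longleftrightarrow>
    (\<forall>x\<in>{a..b}. \<exists>y\<in>{a..b}. inf x y = a \<and> b \<le> j (sup x y))"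
proof -
  have "{a..b} \<in> Fll (nuc_intervals j) \<longleftrightarrow>
    (\<forall>x\<in>{a..b}. \<exists>y\<in>{a..b}. inf x y = a \<and> {sup x y..b} \<in> nuc_intervals j)"
    using assms unfolding Fll_def by (auto simp: Icc_eq_Icc)
  also have "\<dots> \<longleftrightarrow> (\<forall>x\<in>{a..b}. \<exists>y\<in>{a..b}. inf x y = a \<and> b \<le> j (sup x y))"
    by (intro ball_cong bex_cong conj_cong refl atLeastAtMost_mem_nuc_intervals_iff) simp_all
  finally show ?thesis .
qed

theorem proposition4p12:
  fixes j :: "'a::idiom \<Rightarrow> 'a"
  assumes "nucleus j"
  shows "spectral j \<longleftrightarrow>
    (\<forall>a b. a \<le> b \<and> j \<le> chi a b \<longrightarrow> {a..b} \<in> Fll (nuc_intervals j))"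
proof
  note nucleus = nucleus_mono[OF assms] nucleus_le[OF assms] nucleus_inf[OF assms]
    nucleus_idem[OF assms]
  assume "spectral j"
  then have compl: "\<exists>y. j y = y \<and> inf x y = j bot \<and> j (sup x y) = Orderings.top"
    if "j x = x" for x
    using that spectral_iff[OF assms] by blast
  show "\<forall>a b. a \<le> b \<and> j \<le> chi a b \<longrightarrow> {a..b} \<in> Fll (nuc_intervals j)"
  proof (intro allI impI, elim conjE)
    fix a b assume ab: "a \<le> b" and "j \<le> chi a b"
    then have tight: "inf (j a) b = a" using le_chi_iff[OF ab assms] by blast
    have "\<exists>y\<in>{a..b}. inf x y = a \<and> b \<le> j (sup x y)" if x: "x \<in> {a..b}" for x
    proof -
      obtain c where c: "j c = c" "inf (j x) c = j bot" "j (sup (j x) c) = Orderings.top"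
        using compl[of "j x"] nucleus(4) by blast
      \<comment> \<open>The usual relative complement in a modular lattice: \<open>z\<close> is the join of \<open>j a\<close> and \<open>c\<close>
        among the fixed points. The meet with \<open>b\<close> itself, not \<open>j b\<close>, keeps \<open>y\<close> in the interval.\<close>
      define z where "z = j (sup a c)"
      define y where "y = inf z b"
      have a_z: "a \<le> z" and c_z: "c \<le> z"
        using nucleus(2)[of "sup a c"] by (simp_all add: z_def)
      have "a \<le> j x" using x nucleus(2)[of x] by auto
      have "inf (j x) z = j (inf (sup a c) (j x))"
        by (simp add: z_def nucleus(3,4) inf.commute)
      also have "\<dots> = j (sup a (j bot))"
        using modular[OF \<open>a \<le> j x\<close>, of c] c(2) by (simp add: inf.commute)
      also have "\<dots> = j a"
        using nucleus_sup_absorb[OF assms, of bot a] by (simp add: sup.commute)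
      finally have jx_z: "inf (j x) z = j a" .
      have "inf x y \<le> inf (inf (j x) z) b"
        using nucleus(2)[of x] by (simp add: y_def le_infI1 le_infI2)
      then have "inf x y \<le> a" by (simp add: jx_z tight)
      moreover have "y \<in> {a..b}" using a_z ab by (simp add: y_def)
      ultimately have "inf x y = a" using x by (intro antisym) auto
      have "Orderings.top = j (sup x c)"
        using c(3) nucleus_sup_absorb[OF assms] by simp
      also have "\<dots> \<le> j (sup x z)" by (intro nucleus(1) sup_mono c_z order_refl)
      finally have "j (sup x z) = Orderings.top" by (rule top_le)
      moreover have "sup x y = inf (sup x z) b"
        using modular[of x b z] x by (simp add: y_def)
      ultimately have "b \<le> j (sup x y)" using nucleus(2)[of b] by (simp add: nucleus(3))
      with \<open>y \<in> {a..b}\<close> \<open>inf x y = a\<close> show ?thesis by blast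
    qed
    then show "{a..b} \<in> Fll (nuc_intervals j)"
      using atLeastAtMost_mem_Fll_nuc_intervals_iff[OF ab] by blast
  qed
next
  note nucleus = nucleus_mono[OF assms] nucleus_le[OF assms] nucleus_inf[OF assms]
    nucleus_idem[OF assms]
  assume full: "\<forall>a b. a \<le> b \<and> j \<le> chi a b \<longrightarrow> {a..b} \<in> Fll (nuc_intervals j)"
  have "j \<le> chi (j bot) Orderings.top"
    using le_chi_iff[OF top_greatest assms, of "j bot"] nucleus(4) by simp
  then have rel: "\<exists>y. inf x y = j bot \<and> Orderings.top \<le> j (sup x y)" if "j bot \<le> x" for x
    using full atLeastAtMost_mem_Fll_nuc_intervals_iff[OF top_greatest, of "j bot" j] that
    by fastforce
  have "\<exists>y. j y = y \<and> inf x y = j bot \<and> j (sup x y) = Orderings.top" if x: "j x = x" for x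
  proof -
    have "j bot \<le> x" using x by (rule nucleus_bot_le_fixed[OF assms])
    then obtain y where y: "inf x y = j bot" "Orderings.top \<le> j (sup x y)" using rel by blast
    have "inf x (j y) = j bot" using nucleus(3)[of x y] nucleus(4) x y(1) by simp
    moreover have "j (sup x (j y)) = Orderings.top"
      using nucleus_sup_absorb[OF assms, of y x] y(2) by (simp add: sup.commute top_le)
    ultimately show ?thesis using nucleus(4) by blast
  qed
  then show "spectral j" using spectral_iff[OF assms] by blast
qed

end
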